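(* Let $\mathcal{A}\subseteq\mathcal{F}\setminus\{F_3\}$ with $\mathcal{A}\cap\{F_1,F_7\}\neq\emptyset$, where $\mathcal{F}=\{F_1,\dots,F_7\}$. Then $\mathrm{ex}(n,\mathcal{A})=\Theta(n^2)$ as $n\to\infty$.
   Context: A triple system $H=(V,E)$ has a finite vertex set $V$, and $E$ is a set of $3$-element subsets of $V$ (no repeated triples). For a family $\mathcal{H}$ of triple systems, $\mathrm{ex}(n,\mathcal{H})$ is the maximum number of triples in a triple system on $n$ vertices that does not contain (an isomorphic copy of) any member of $\mathcal{H}$ as a (not necessarily induced) subsystem. A special four cycle has four distinct base vertices $v_1,v_2,v_3,v_4$ and four triples $\{w_i,v_i,v_{i+1}\}$, $i=1,2,3,4$ (indices modulo $4$), where the $w_j$ are not necessarily distinct but $w_i\neq v_j$ for all $1\le i,j\le 4$. Up to isomorphism there are seven, forming $\mathcal{F}=\{F_1,\dots,F_7\}$, given by exactly the following coincidences among the $w_j$ (no other coincidences): $F_1$: all $w_j$ different; $F_2$: $w_1=w_2=w_3=w_4$; $F_3$: $w_1=w_2$ and $w_3=w_4$; $F_4$: $w_1=w_3$ and $w_2=w_4$ (the Pasch configuration); $F_5$: $w_1=w_2=w_3$; $F_6$: $w_1=w_3$; $F_7$: $w_1=w_2$. *)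

theory Defs
  imports Complex_Main "HOL-Library.Landau_Symbols"
begin

type_synonym 'a hypergraph = "'a set \<times> 'a set set"

definition triple_system :: "'a hypergraph \<Rightarrow> bool" where
  "triple_system H \<longleftrightarrow> finite (fst H) \<and> (\<forall>e\<in>snd H. e \<subseteq> fst H \<and> card e = 3)"

definition subsystem :: "'a hypergraph \<Rightarrow> 'a hypergraph \<Rightarrow> bool" where
  "subsystem H' H \<longleftrightarrow> fst H' \<subseteq> fst H \<and> snd H' \<subseteq> snd H"

definition isomorphic :: "'a hypergraph \<Rightarrow> 'b hypergraph \<Rightarrow> bool" where
  "isomorphic G H \<longleftrightarrow> (\<exists>f. bij_betw f (fst G) (fst H) \<and> snd H = (\<lambda>e. f ` e) ` snd G)"

definition contains_copy :: "'a hypergraph \<Rightarrow> 'b hypergraph \<Rightarrow> bool" where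
  "contains_copy H F \<longleftrightarrow> (\<exists>H'. triple_system H' \<and> subsystem H' H \<and> isomorphic F H')"

(* Every triple system on n vertices is isomorphic to one whose vertices are natural numbers, so
   it suffices to let the host systems range over these. The set below is finite, and it contains 0
   whenever every member of the family has at least one triple. *)
definition ex_number :: "nat \<Rightarrow> 'b hypergraph set \<Rightarrow> nat" where
  "ex_number n \<H> =
     Max {card (snd H) | H :: nat hypergraph.
            triple_system H \<and> card (fst H) = n \<and> (\<forall>F\<in>\<H>. \<not> contains_copy H F)}"

(* Indices run over 0, 1, 2, 3, so v i and w i stand for the usual v_(i+1) and w_(i+1). *)
definition four_cycle :: "(nat \<Rightarrow> 'a) \<Rightarrow> (nat \<Rightarrow> 'a) \<Rightarrow> 'a hypergraph" where
  "four_cycle v w =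
     (v ` {..<4} \<union> w ` {..<4}, (\<lambda>i. {w i, v i, v ((i + 1) mod 4)}) ` {..<4})"

definition special_four_cycle :: "'a hypergraph \<Rightarrow> bool" where
  "special_four_cycle H \<longleftrightarrow>
     (\<exists>v w. inj_on v {..<4} \<and> (\<forall>i<4. \<forall>j<4. w i \<noteq> v j) \<and> H = four_cycle v w)"

(* Representatives of the seven isomorphism types: base vertices 0, 1, 2, 3, and the list gives
   the remaining vertices w_1, w_2, w_3, w_4 of the four triples. *)
definition base_cycle :: "nat list \<Rightarrow> nat hypergraph" where
  "base_cycle ws = four_cycle (\<lambda>i. i) (\<lambda>i. ws ! i)"

definition F1 :: "nat hypergraph" where "F1 = base_cycle [4, 5, 6, 7]"
definition F2 :: "nat hypergraph" where "F2 = base_cycle [4, 4, 4, 4]"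
definition F3 :: "nat hypergraph" where "F3 = base_cycle [4, 4, 5, 5]"
definition F4 :: "nat hypergraph" where "F4 = base_cycle [4, 5, 4, 5]"
definition F5 :: "nat hypergraph" where "F5 = base_cycle [4, 4, 4, 5]"
definition F6 :: "nat hypergraph" where "F6 = base_cycle [4, 5, 4, 6]"
definition F7 :: "nat hypergraph" where "F7 = base_cycle [4, 4, 5, 6]"

definition special_four_cycles :: "nat hypergraph set" where
  "special_four_cycles = {F1, F2, F3, F4, F5, F6, F7}"

lemma triples_base_cycle:
  "snd (base_cycle [a, b, c, d]) = {{a, 0, 1}, {b, 1, 2}, {c, 2, 3}, {d, 3, 0}}"
proof -
  have "{..<4::nat} = {0, 1, 2, 3}" by auto
  then show ?thesis
    unfolding base_cycle_def four_cycle_def by (simp add: Suc_1 [unfolded One_nat_def])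
qed

lemma special_four_cycle_base_cycle:
  assumes "length ws = 4" and ge: "\<And>x. x \<in> set ws \<Longrightarrow> x \<ge> 4"
  shows "special_four_cycle (base_cycle ws)"
proof -
  have "ws ! i \<noteq> j" if "i < 4" "j < 4" for i j :: nat
    using ge[of "ws ! i"] that assms(1) by force
  then show ?thesis
    unfolding special_four_cycle_def base_cycle_def by (metis inj_on_id2)
qed

lemma special_four_cycles_special:
  assumes "F \<in> special_four_cycles"
  shows "special_four_cycle F"
proof -
  have "\<exists>ws. F = base_cycle ws \<and> length ws = 4 \<and> (\<forall>x\<in>set ws. x \<ge> 4)"
    using assms
    unfolding special_four_cycles_def F1_def F2_def F3_def F4_def F5_def F6_def F7_def
    by (elim insertE emptyE; intro exI conjI) (assumption | simp)+
  then show ?thesis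
    using special_four_cycle_base_cycle by blast
qed

end

theory Submission
  imports Defs
begin

text \<open>
  Lower bound. Cut the vertices into a set of disjoint pairs and a set of single vertices, both
  of linear size, and take every triple that consists of a pair and a single vertex. This is a
  complete bipartite graph in which one side has been doubled. In a special four cycle the base
  vertices must alternate between single vertices and members of pairs, and the two triples at a
  member of a pair are forced to share its partner. Hence every special four cycle in this system
  is an \<^const>\<open>F3\<close> (lemma \<open>paired_triples_cycle\<close>), and there are quadratically many triples.

  Upper bound. A system with \<open>C n\<^sup>2\<close> triples keeps many of them after deleting the triples on pairs
  of low codegree (lemma \<open>exists_rich_subsystem\<close>), so we may assume that each pair covered by a
  triple is covered by at least six. Then a four cycle in the shadow graph extends to a special
  four cycle, with the remaining vertices chosen greedily.

  For \<^const>\<open>F1\<close> one such four cycle suffices, and two triples on a common pair provide it. So a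
  rich system without \<^const>\<open>F1\<close> is empty.

  For \<^const>\<open>F7\<close> let \<open>d\<close> be the degree in the shadow. If \<open>a\<close> and \<open>b\<close> both form a triple with the pair
  \<open>w u\<close>, then \<open>w\<close> and \<open>u\<close> are their only common neighbours in the shadow, since any other one would
  close an \<^const>\<open>F7\<close>. So the neighbourhoods of the vertices \<open>a\<close> that complete a fixed pair are
  almost disjoint, and their degrees add up to at most \<open>2n\<close>. Now count each ordered triple
  \<open>(w, u, a)\<close> with weight \<open>d(a) / d(w)\<close>. For fixed \<open>w\<close> there are \<open>d(w)\<close> choices of \<open>u\<close>, so the total
  weight is at most \<open>2 n\<^sup>2\<close>. Reversing a triple inverts its weight, and \<open>x + 1 / x \<ge> 2\<close>, so the
  average weight is at least \<open>1\<close> and there are at most \<open>2 n\<^sup>2\<close> ordered triples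
  (lemma \<open>card_rich_F7_free\<close>). The weights are needed because the degrees \<open>d\<close> may vary a lot.
\<close>

section \<open>Copies of special four cycles\<close>

lemma vertices_base_cycle:
  "fst (base_cycle [a, b, c, d]) = {0, 1, 2, 3, a, b, c, d}"
proof -
  have "{..<4} = {0, 1, 2, 3 :: nat}"
    by auto
  then show ?thesis
    by (auto simp: base_cycle_def four_cycle_def)
qed

text \<open>The list \<open>L\<close> is the embedding: vertex \<open>i\<close> of the cycle goes to entry \<open>i\<close>.\<close>

lemma contains_copy_base_cycleI:
  assumes H: "triple_system H"
    and L: "distinct L" "4 \<le> length L"
    and ws: "a < length L" "b < length L" "c < length L" "d < length L"
    and edges: "{L ! a, L ! 0, L ! 1} \<in> snd H" "{L ! b, L ! 1, L ! 2} \<in> snd H"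
      "{L ! c, L ! 2, L ! 3} \<in> snd H" "{L ! d, L ! 3, L ! 0} \<in> snd H"
  shows "contains_copy H (base_cycle [a, b, c, d])"
proof -
  let ?F = "base_cycle [a, b, c, d]"
  let ?f = "\<lambda>i. L ! i"
  let ?H' = "(?f ` fst ?F, (\<lambda>e. ?f ` e) ` snd ?F)"
  note F = vertices_base_cycle triples_base_cycle
  have inj: "inj_on ?f (fst ?F)"
    using ws L(2) by (intro inj_on_nth[OF L(1)]) (auto simp: F)
  have sub: "snd ?H' \<subseteq> snd H"
    using edges by (simp add: F)
  have cover: "\<Union> (snd ?H') = fst ?H'"
    unfolding F by auto
  have inside: "e \<subseteq> fst H" "card e = 3" if "e \<in> snd H" for e
    using that H by (auto simp: triple_system_def)
  have "fst ?H' \<subseteq> fst H"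
    unfolding cover[symmetric] using sub inside(1) by blast
  then have "subsystem ?H' H"
    using sub by (simp add: subsystem_def)
  moreover have "triple_system ?H'"
    unfolding triple_system_def
  proof (intro conjI ballI)
    show "finite (fst ?H')"
      by (simp add: F)
    fix e
    assume "e \<in> snd ?H'"
    then show "e \<subseteq> fst ?H'" "card e = 3"
      using cover sub inside(2) by blast+
  qed
  moreover have "isomorphic ?F ?H'"
    unfolding isomorphic_def using inj by (intro exI[of _ ?f]) (simp add: bij_betw_def)
  ultimately show ?thesis
    unfolding contains_copy_def by blast
qed

lemma contains_copy_base_cycleE:
  assumes "contains_copy H (base_cycle [a, b, c, d])"
  obtains f :: "nat \<Rightarrow> 'a" where "inj_on f {0, 1, 2, 3, a, b, c, d}"
    "{f a, f 0, f 1} \<in> snd H" "{f b, f 1, f 2} \<in> snd H"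
    "{f c, f 2, f 3} \<in> snd H" "{f d, f 3, f 0} \<in> snd H"
proof -
  let ?F = "base_cycle [a, b, c, d]"
  obtain H' f where H': "subsystem H' H" "bij_betw f (fst ?F) (fst H')"
      "snd H' = (\<lambda>e. f ` e) ` snd ?F"
    using assms unfolding contains_copy_def isomorphic_def by blast
  have "inj_on f {0, 1, 2, 3, a, b, c, d}"
    using H'(2) by (simp add: vertices_base_cycle bij_betw_def)
  moreover have "(\<lambda>e. f ` e) ` snd ?F \<subseteq> snd H"
    using H'(1,3) by (simp add: subsystem_def)
  ultimately show thesis
    using that[of f] by (simp add: triples_base_cycle)
qed

section \<open>The lower bound\<close>

definition paired_triples :: "nat \<Rightarrow> nat \<Rightarrow> nat set set" where
  "paired_triples m n = (\<lambda>(i, z). {2 * i, 2 * i + 1, z}) ` ({..<m} \<times> {2 * m..<n})"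

lemma triple_system_paired_triples:
  assumes "2 * m \<le> n"
  shows "triple_system ({..<n}, paired_triples m n)"
  using assms unfolding triple_system_def paired_triples_def by (auto simp: card_insert_if)

lemma card_paired_triples:
  "card (paired_triples m n) = m * (n - 2 * m)"
proof -
  have "inj_on (\<lambda>(i, z). {2 * i, 2 * i + 1, z}) ({..<m} \<times> {2 * m..<n})"
  proof (rule inj_onI, clarsimp)
    fix i z j y :: nat
    assume *: "i < m" "j < m" "2 * m \<le> z" "2 * m \<le> y"
      and eq: "{2 * i, Suc (2 * i), z} = {2 * j, Suc (2 * j), y}"
    have "z \<in> {2 * j, Suc (2 * j), y}" "2 * i \<in> {2 * j, Suc (2 * j), y}"
      using eq by blast+
    then show "i = j \<and> z = y"
      using * by auto
  qed
  then show ?thesis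
    unfolding paired_triples_def by (simp add: card_image card_cartesian_product)
qed

text \<open>The vertices below \<open>2 m\<close> are the members of pairs, so a triple has exactly two of them.\<close>

lemma paired_triplesD:
  assumes "{x, y, z} \<in> paired_triples m n" and "x \<noteq> y" "x \<noteq> z" "y \<noteq> z"
  shows "(x < 2 * m \<and> y < 2 * m \<and> z \<ge> 2 * m \<and> x div 2 = y div 2) \<or>
         (x < 2 * m \<and> z < 2 * m \<and> y \<ge> 2 * m \<and> x div 2 = z div 2) \<or>
         (y < 2 * m \<and> z < 2 * m \<and> x \<ge> 2 * m \<and> y div 2 = z div 2)"
proof -
  obtain i t where it: "i < m" "2 * m \<le> t" "{x, y, z} = {2 * i, 2 * i + 1, t}"
    using assms(1) unfolding paired_triples_def by auto
  have "x \<in> {2 * i, 2 * i + 1, t}" "y \<in> {2 * i, 2 * i + 1, t}" "z \<in> {2 * i, 2 * i + 1, t}"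
    using it(3) by blast+
  then show ?thesis
    using it(1,2) assms(2-4) by auto
qed

text \<open>
  At a base vertex \<open>q\<close> that belongs to a pair, the partner lies in both triples through \<open>q\<close>. It is
  not a base vertex, because neither \<open>p\<close> nor \<open>r\<close> lies in both.
\<close>

lemma paired_triples_corner:
  assumes "{w, p, q} \<in> paired_triples m n" "{w', q, r} \<in> paired_triples m n"
    and "p \<noteq> q" "q \<noteq> r" "p \<noteq> r" "w \<notin> {p, q, r}" "w' \<notin> {p, q, r}" and q: "q < 2 * m"
  shows "w = w' \<and> w < 2 * m \<and> w div 2 = q div 2 \<and> 2 * m \<le> p \<and> 2 * m \<le> r"
proof -
  have mate: "x = y" if "x div 2 = q div 2" "y div 2 = q div 2" "x \<noteq> q" "y \<noteq> q" for x y :: nat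
    using that by presburger
  show ?thesis
    using paired_triplesD[OF assms(1)] paired_triplesD[OF assms(2)] assms(3-) mate
    by (smt (verit) insertCI not_le)
qed

text \<open>The two alternatives differ by a rotation; both say that the cycle is an \<^const>\<open>F3\<close>.\<close>

lemma paired_triples_cycle:
  assumes E: "{w0, v0, v1} \<in> paired_triples m n" "{w1, v1, v2} \<in> paired_triples m n"
      "{w2, v2, v3} \<in> paired_triples m n" "{w3, v3, v0} \<in> paired_triples m n"
    and v: "distinct [v0, v1, v2, v3]"
    and w: "{w0, w1, w2, w3} \<inter> {v0, v1, v2, v3} = {}"
  shows "w0 = w1 \<and> w2 = w3 \<and> w0 \<noteq> w2 \<or> w0 = w3 \<and> w1 = w2 \<and> w0 \<noteq> w1"
proof -
  have two: "x = y \<or> x = z \<or> y = z" if "x div 2 = c" "y div 2 = c" "z div 2 = c" for x y z c :: nat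
    using that by presburger
  have single: "x < 2 * m" if "{w, x, y} \<in> paired_triples m n" "w \<noteq> x" "w \<noteq> y" "x \<noteq> y"
      "2 * m \<le> y" for w x y
    using paired_triplesD[OF that(1-4)] that(5) by auto
  show ?thesis
  proof (cases "v1 < 2 * m")
    case True
    have 1: "w0 = w1" "w0 div 2 = v1 div 2" "2 * m \<le> v0"
      using paired_triples_corner[OF E(1,2)] v w True by auto
    have "v3 < 2 * m"
      using single[OF E(4)] v w 1(3) by auto
    then have 2: "w2 = w3" "w2 div 2 = v3 div 2"
      using paired_triples_corner[OF E(3,4)] v w by auto
    have "w0 \<noteq> w2"
      using two[of w0 "v1 div 2" v1 v3] 1(2) 2(2) v w by auto
    then show ?thesis
      using 1 2 by blast
  next
    case False
    have "v0 < 2 * m" "v2 < 2 * m"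
      using single[of w0 v0 v1] single[of w1 v2 v1] E False v w by (auto simp: insert_commute)
    then have 1: "w3 = w0" "w3 div 2 = v0 div 2" "w1 = w2" "w1 div 2 = v2 div 2"
      using paired_triples_corner[OF E(4,1)] paired_triples_corner[OF E(2,3)] v w by auto
    have "w0 \<noteq> w1"
      using two[of w0 "v0 div 2" v0 v2] 1 v w by auto
    then show ?thesis
      using 1 by blast
  qed
qed

lemma paired_triples_free:
  assumes "F \<in> special_four_cycles - {F3}"
  shows "\<not> contains_copy (V, paired_triples m n) F"
proof
  assume copy: "contains_copy (V, paired_triples m n) F"
  obtain a b c d where F: "F = base_cycle [a, b, c, d]"
    and ge: "4 \<le> a" "4 \<le> b" "4 \<le> c" "4 \<le> d"
    and not: "\<not> (a = b \<and> c = d \<and> a \<noteq> c \<or> a = d \<and> b = c \<and> a \<noteq> b)"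
  proof -
    have "F \<in> {F1, F2, F4, F5, F6, F7}"
      using assms by (auto simp: special_four_cycles_def)
    then show thesis
      using that[of 4 5 6 7] that[of 4 4 4 4] that[of 4 5 4 5] that[of 4 4 4 5] that[of 4 5 4 6]
        that[of 4 4 5 6]
      by (auto simp: F1_def F2_def F4_def F5_def F6_def F7_def)
  qed
  obtain f where inj: "inj_on f {0, 1, 2, 3, a, b, c, d}"
    and edges: "{f a, f 0, f 1} \<in> paired_triples m n" "{f b, f 1, f 2} \<in> paired_triples m n"
      "{f c, f 2, f 3} \<in> paired_triples m n" "{f d, f 3, f 0} \<in> paired_triples m n"
    by (rule contains_copy_base_cycleE[OF copy[unfolded F]]) auto
  note edges
  moreover have "distinct [f 0, f 1, f 2, f 3]"
    using inj by (auto simp: inj_on_def)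
  moreover have "f x \<noteq> f i" if "x \<in> {a, b, c, d}" "i \<in> {0, 1, 2, 3}" for x i
    using inj_onD[OF inj, of x i] that ge by auto
  then have "{f a, f b, f c, f d} \<inter> {f 0, f 1, f 2, f 3} = {}"
    by blast
  ultimately have "f a = f b \<and> f c = f d \<and> f a \<noteq> f c \<or> f a = f d \<and> f b = f c \<and> f a \<noteq> f b"
    by (rule paired_triples_cycle)
  then show False
    using not inj_onD[OF inj] by (metis insertCI)
qed

section \<open>Systems in which every covered pair has large codegree\<close>

text \<open>
  Once all members of \<open>E\<close> have three elements, \<open>{x, y, z} \<in> E\<close> forces \<open>x\<close>, \<open>y\<close>, \<open>z\<close> to be distinct.
  So the shadow is then a loopless graph, given by its ordered pairs, and \<open>z\<close> differs from \<open>x\<close>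
  and \<open>y\<close>.
\<close>

definition coneighbours :: "'a set set \<Rightarrow> 'a \<Rightarrow> 'a \<Rightarrow> 'a set" where
  "coneighbours E x y = {z. {x, y, z} \<in> E}"

definition shadow :: "'a set set \<Rightarrow> ('a \<times> 'a) set" where
  "shadow E = {(x, y). \<exists>z. {x, y, z} \<in> E}"

definition rich :: "nat \<Rightarrow> 'a set set \<Rightarrow> bool" where
  "rich k E \<longleftrightarrow> (\<forall>(x, y)\<in>shadow E. k \<le> card (coneighbours E x y))"

lemma shadowI:
  assumes "{x, y, z} \<in> E"
  shows "(x, y) \<in> shadow E" "(y, x) \<in> shadow E" "(x, z) \<in> shadow E" "(z, x) \<in> shadow E"
    "(y, z) \<in> shadow E" "(z, y) \<in> shadow E"
  using assms by (auto simp: shadow_def) (metis insert_commute)+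

lemma triple_distinct:
  assumes "card {x, y, z} = 3"
  shows "x \<noteq> y" "x \<noteq> z" "y \<noteq> z"
  using assms by (auto simp: card_insert_if split: if_splits)

lemma shadow_irrefl:
  assumes "\<And>e. e \<in> E \<Longrightarrow> card e = 3"
  shows "(x, x) \<notin> shadow E"
proof
  assume "(x, x) \<in> shadow E"
  then obtain z where "{x, x, z} \<in> E"
    unfolding shadow_def by blast
  then show False
    using triple_distinct(1)[OF assms] by blast
qed

text \<open>
  A maximiser \<open>E'\<close> of \<open>|E'| - k |shadow E'|\<close> is rich: deleting the triples on a pair removes that
  pair from the shadow, so a pair with fewer than \<open>k\<close> triples would allow an improvement.
\<close>

lemma exists_rich_subsystem:
  fixes E :: "'a set set"
  assumes fin: "finite V" and E: "\<forall>e\<in>E. e \<subseteq> V \<and> card e = 3"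
  obtains E' where "E' \<subseteq> E" "rich k E'" "card E \<le> card E' + k * (card V)\<^sup>2"
proof -
  define val where "val E' = int (card E') - int k * int (card (shadow E'))" for E' :: "'a set set"
  have finE: "finite E"
    using fin E by (meson PowI finite_Pow_iff finite_subset subsetI)
  have sh: "shadow E' \<subseteq> V \<times> V" if "E' \<subseteq> E" for E'
  proof clarify
    fix x y
    assume "(x, y) \<in> shadow E'"
    then obtain z where "{x, y, z} \<in> E'"
      by (auto simp: shadow_def)
    then have "{x, y, z} \<in> E"
      using that by (rule rev_subsetD)
    from bspec[OF E this] show "x \<in> V \<and> y \<in> V"
      by simp
  qed
  then have fin_sh: "finite (shadow E')" if "E' \<subseteq> E" for E'
    using that fin by (meson finite_SigmaI finite_subset)
  have "finite (val ` Pow E)" "val ` Pow E \<noteq> {}"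
    using finE by auto
  from Max_in[OF this] obtain E' where E': "E' \<subseteq> E" "val E' = Max (val ` Pow E)"
    by auto
  have max: "val D \<le> val E'" if "D \<subseteq> E" for D
    using that finE by (simp add: E'(2))
  have "k \<le> card (coneighbours E' x y)" if xy: "(x, y) \<in> shadow E'" for x y
  proof -
    let ?R = "(\<lambda>z. {x, y, z}) ` coneighbours E' x y"
    let ?D = "E' - ?R"
    have "coneighbours E' x y \<subseteq> V"
    proof
      fix z
      assume "z \<in> coneighbours E' x y"
      then have "(x, z) \<in> shadow E'"
        unfolding coneighbours_def by (intro shadowI(3)) simp
      then show "z \<in> V"
        using sh[OF E'(1)] by blast
    qed
    then have fin_co: "finite (coneighbours E' x y)"
      using fin finite_subset by blast
    have "shadow ?D \<subseteq> shadow E' - {(x, y)}"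
      by (auto simp: shadow_def coneighbours_def)
    then have "card (shadow ?D) \<le> card (shadow E' - {(x, y)})"
      using fin_sh[OF E'(1)] by (intro card_mono) auto
    also have "\<dots> = card (shadow E') - 1"
      using xy by simp
    finally have less: "card (shadow ?D) + 1 \<le> card (shadow E')"
      using xy fin_sh[OF E'(1)] card_gt_0_iff[of "shadow E'"] by fastforce
    have "?R \<subseteq> E'"
      by (auto simp: coneighbours_def)
    then have "card E' = card ?D + card ?R"
      using finite_subset[OF E'(1) finE] by (metis card_Diff_subset card_mono finite_subset
        le_add_diff_inverse2)
    moreover have "card ?R \<le> card (coneighbours E' x y)"
      by (rule card_image_le[OF fin_co])
    moreover have "val ?D \<le> val E'"
      using E'(1) by (intro max) auto
    moreover have "int k * (int (card (shadow ?D)) + 1) \<le> int k * int (card (shadow E'))"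
      using less by (intro mult_left_mono) auto
    ultimately show ?thesis
      by (simp add: val_def distrib_left)
  qed
  then have "rich k E'"
    by (auto simp: rich_def)
  moreover have "card E \<le> card E' + k * (card V)\<^sup>2"
  proof -
    have "card (shadow E) \<le> (card V)\<^sup>2"
      using card_mono[OF _ sh[OF order.refl]] fin by (simp add: card_cartesian_product power2_eq_square)
    then have "k * card (shadow E) \<le> k * (card V)\<^sup>2"
      by simp
    moreover have "val E \<le> val E'"
      by (rule max) simp
    then have "int (card E) \<le> int (card E') + int (k * card (shadow E))"
      by (simp add: val_def) (smt (verit) of_nat_0_le_iff zero_le_mult_iff)
    ultimately show ?thesis
      by linarith
  qed
  ultimately show thesis
    using that E'(1) by blast
qed

lemma rich_fresh_coneighbour:
  assumes "rich k E" "(x, y) \<in> shadow E" "length zs < k"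
  obtains z where "{x, y, z} \<in> E" "z \<notin> set zs"
proof -
  have "card (set zs) < card (coneighbours E x y)"
    using assms card_length[of zs] by (auto simp: rich_def)
  then have "\<not> coneighbours E x y \<subseteq> set zs"
    using card_mono[OF finite_set] by (metis not_le)
  then show thesis
    using that by (auto simp: coneighbours_def)
qed

text \<open>
  With \<open>k = 6\<close> the greedy choice of the vertices \<open>w_i\<close> never gets stuck: each has to avoid the two
  base vertices outside its triple and at most three vertices chosen before.
\<close>

lemma rich_F1_free_empty:
  assumes H: "triple_system (V, E)" and E': "E' \<subseteq> E" "rich 6 E'"
    and free: "\<not> contains_copy (V, E) F1"
  shows "E' = {}"
proof (rule ccontr)
  assume "E' \<noteq> {}"
  have three: "card e = 3" if "e \<in> E'" for e
    using that H E'(1) by (auto simp: triple_system_def)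
  obtain e where "e \<in> E'"
    using \<open>E' \<noteq> {}\<close> by blast
  then obtain a b c where abc: "{a, b, c} \<in> E'"
    using three by (metis card_3_iff)
  then have "(a, b) \<in> shadow E'"
    by (auto simp: shadow_def)
  then obtain d where abd: "{a, b, d} \<in> E'" "d \<notin> {c}"
    using rich_fresh_coneighbour[OF E'(2), of a b "[c]"] by auto
  have dist: "distinct [a, c, b, d]"
    using triple_distinct[OF three[OF abc]] triple_distinct[OF three[OF abd(1)]] abd(2) by auto
  have sh: "(a, c) \<in> shadow E'" "(c, b) \<in> shadow E'" "(b, d) \<in> shadow E'" "(d, a) \<in> shadow E'"
    using shadowI[OF abc] shadowI[OF abd(1)] by blast+
  obtain w1 where w1: "{a, c, w1} \<in> E'" "w1 \<notin> {b, d}"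
    using rich_fresh_coneighbour[OF E'(2) sh(1), of "[b, d]"] by auto
  obtain w2 where w2: "{c, b, w2} \<in> E'" "w2 \<notin> {a, d, w1}"
    using rich_fresh_coneighbour[OF E'(2) sh(2), of "[a, d, w1]"] by auto
  obtain w3 where w3: "{b, d, w3} \<in> E'" "w3 \<notin> {a, c, w1, w2}"
    using rich_fresh_coneighbour[OF E'(2) sh(3), of "[a, c, w1, w2]"]
    by auto
  obtain w4 where w4: "{d, a, w4} \<in> E'" "w4 \<notin> {b, c, w1, w2, w3}"
    using rich_fresh_coneighbour[OF E'(2) sh(4), of "[b, c, w1, w2, w3]"]
    by auto
  let ?L = "[a, c, b, d, w1, w2, w3, w4]"
  have L: "distinct ?L"
    using dist w1(2) w2(2) w3(2) w4(2) triple_distinct[OF three[OF w1(1)]]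
      triple_distinct[OF three[OF w2(1)]] triple_distinct[OF three[OF w3(1)]]
      triple_distinct[OF three[OF w4(1)]] by auto
  have edges: "{w1, a, c} \<in> E" "{w2, c, b} \<in> E" "{w3, b, d} \<in> E" "{w4, d, a} \<in> E"
    using E'(1) w1(1) w2(1) w3(1) w4(1) by (auto simp: insert_commute)
  have "contains_copy (V, E) F1"
    unfolding F1_def using edges by (intro contains_copy_base_cycleI[OF H L]) simp_all
  then show False
    using free by blast
qed

text \<open>For any other \<open>x\<close>, the cycle \<open>a u b x\<close> would be the base of an \<^const>\<open>F7\<close> whose repeated vertex
  is \<open>w\<close>.\<close>

lemma rich_F7_free_common_neighbours:
  assumes H: "triple_system (V, E)" and E': "E' \<subseteq> E" "rich 6 E'"
    and free: "\<not> contains_copy (V, E) F7"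
    and a: "{w, u, a} \<in> E'" and b: "{w, u, b} \<in> E'" and "a \<noteq> b"
    and x: "(a, x) \<in> shadow E'" "(b, x) \<in> shadow E'"
  shows "x = w \<or> x = u"
proof (rule ccontr)
  assume nx: "\<not> (x = w \<or> x = u)"
  have three: "card e = 3" if "e \<in> E'" for e
    using that H E'(1) by (auto simp: triple_system_def)
  have "a \<noteq> x" "b \<noteq> x"
    using x shadow_irrefl[OF three] by blast+
  then have dist: "distinct [a, u, b, x, w]"
    using triple_distinct[OF three[OF a]] triple_distinct[OF three[OF b]] nx \<open>a \<noteq> b\<close> by auto
  obtain w3 where w3: "{b, x, w3} \<in> E'" "w3 \<notin> {a, u, w}"
    using rich_fresh_coneighbour[OF E'(2) x(2), of "[a, u, w]"] by auto
  obtain w4 where w4: "{a, x, w4} \<in> E'" "w4 \<notin> {b, u, w, w3}"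
    using rich_fresh_coneighbour[OF E'(2) x(1), of "[b, u, w, w3]"] by auto
  let ?L = "[a, u, b, x, w, w3, w4]"
  have L: "distinct ?L"
    using dist w3(2) w4(2) triple_distinct[OF three[OF w3(1)]]
      triple_distinct[OF three[OF w4(1)]] by auto
  have edges: "{w, a, u} \<in> E" "{w, u, b} \<in> E" "{w3, b, x} \<in> E" "{w4, x, a} \<in> E"
    using E'(1) a b w3(1) w4(1) by (auto simp: insert_commute)
  have "contains_copy (V, E) F7"
    unfolding F7_def using edges by (intro contains_copy_base_cycleI[OF H L]) simp_all
  then show False
    using free by blast
qed

section \<open>Counting with weights\<close>

text \<open>
  Counting the ordered triple \<open>(w, u, a)\<close> with weight \<open>d a / d w\<close> is a spectral argument. For a
  nonnegative symmetric matrix \<open>c\<close> and a positive vector \<open>d\<close>, an inequality \<open>c d \<le> r d\<close> bounds the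
  spectral radius of \<open>c\<close> by \<open>r\<close>, and so the sum of all entries by \<open>r\<close> times the dimension. Here \<open>c\<close>
  holds the codegrees and \<open>d\<close> the shadow degrees.
\<close>

lemma card_ordered_triples_le:
  fixes E :: "'a set set" and d :: "'a \<Rightarrow> real"
  assumes fin: "finite V" and E: "\<forall>e\<in>E. e \<subseteq> V"
    and d: "\<And>x. d x = real (card (shadow E `` {x}))"
    and r: "\<And>w u. (w, u) \<in> shadow E \<Longrightarrow> (\<Sum>a\<in>coneighbours E w u. d a) \<le> r" "0 \<le> r"
  shows "real (card {(w, u, a). {w, u, a} \<in> E}) \<le> r * real (card V)"
proof -
  define Q where "Q = {(w, u, a). {w, u, a} \<in> E}"
  have Q: "Q = (SIGMA w:V. SIGMA u:shadow E `` {w}. coneighbours E w u)"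
    using E by (auto simp: Q_def shadow_def coneighbours_def)
  have nb: "finite (shadow E `` {w})" for w
    using E by (intro finite_subset[OF _ fin]) (auto simp: shadow_def)
  have co: "finite (coneighbours E w u)" for w u
    using E by (intro finite_subset[OF _ fin]) (auto simp: coneighbours_def)
  have pos: "0 < d w" if "u \<in> shadow E `` {w}" for w u
    using that nb[of w] by (auto simp: d card_gt_0_iff)
  define S where "S = (\<Sum>(w, u, a)\<in>Q. d a / d w)"
  have "S = (\<Sum>(w, u, a)\<in>Q. d w / d a)"
    unfolding S_def
    by (rule sum.reindex_bij_witness[where i = "\<lambda>(w, u, a). (a, u, w)" and j = "\<lambda>(w, u, a). (a, u, w)"])
      (auto simp: Q_def insert_commute)
  then have "2 * S = (\<Sum>(w, u, a)\<in>Q. d a / d w + d w / d a)"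
    by (simp add: S_def sum.distrib case_prod_unfold)
  also have "\<dots> \<ge> (\<Sum>(w, u, a)\<in>Q. 2)"
  proof (rule sum_mono, clarify)
    fix w u a
    assume "(w, u, a) \<in> Q"
    then have "u \<in> shadow E `` {w}" "u \<in> shadow E `` {a}"
      by (auto simp: Q_def shadow_def insert_commute)
    then have p: "0 < d w" "0 < d a"
      using pos by blast+
    have "0 \<le> (d a - d w)\<^sup>2"
      by simp
    then show "2 \<le> d a / d w + d w / d a"
      using p by (simp add: field_simps power2_eq_square)
  qed
  finally have "real (card Q) \<le> S"
    by (simp add: case_prod_unfold)
  also have "S = (\<Sum>w\<in>V. \<Sum>u\<in>shadow E `` {w}. \<Sum>a\<in>coneighbours E w u. d a / d w)"
    unfolding S_def Q using fin nb co by (simp add: sum.Sigma)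
  also have "\<dots> \<le> (\<Sum>w\<in>V. r)"
  proof (rule sum_mono)
    fix w
    assume "w \<in> V"
    have "(\<Sum>u\<in>shadow E `` {w}. \<Sum>a\<in>coneighbours E w u. d a / d w)
        \<le> (\<Sum>u\<in>shadow E `` {w}. r / d w)"
    proof (rule sum_mono)
      fix u
      assume u: "u \<in> shadow E `` {w}"
      have "(\<Sum>a\<in>coneighbours E w u. d a / d w) = (\<Sum>a\<in>coneighbours E w u. d a) / d w"
        by (simp add: sum_divide_distrib)
      also have "\<dots> \<le> r / d w"
        using r(1)[of w u] u pos[OF u] by (intro divide_right_mono) auto
      finally show "(\<Sum>a\<in>coneighbours E w u. d a / d w) \<le> r / d w" .
    qed
    also have "\<dots> \<le> r"
      using r(2) by (simp add: d)
    finally show "(\<Sum>u\<in>shadow E `` {w}. \<Sum>a\<in>coneighbours E w u. d a / d w) \<le> r" .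
  qed
  also have "\<dots> = r * real (card V)"
    by simp
  finally show ?thesis
    by (simp add: Q_def)
qed

text \<open>
  The neighbourhoods of the vertices completing \<open>w u\<close>, with \<open>w\<close> and \<open>u\<close> removed, are disjoint. The
  removal costs at most half of each degree, as richness makes all degrees at least six.
\<close>

lemma rich_F7_free_degree_sum:
  assumes H: "triple_system (V, E)" and E': "E' \<subseteq> E" "rich 6 E'"
    and free: "\<not> contains_copy (V, E) F7"
  shows "(\<Sum>a\<in>coneighbours E' w u. real (card (shadow E' `` {a}))) \<le> 2 * real (card V)"
proof -
  let ?N = "\<lambda>a. shadow E' `` {a}"
  let ?C = "coneighbours E' w u"
  have fin: "finite V" and EV: "\<And>e. e \<in> E' \<Longrightarrow> e \<subseteq> V"
    using H E'(1) by (auto simp: triple_system_def)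
  have NV: "?N a \<subseteq> V" for a
    using EV by (auto simp: shadow_def)
  then have finN: "finite (?N a)" for a
    using fin finite_subset by blast
  have finC: "finite ?C"
    using EV by (intro finite_subset[OF _ fin]) (auto simp: coneighbours_def)
  have half: "real (card (?N a)) \<le> 2 * real (card (?N a - {w, u}))" if a: "a \<in> ?C" for a
  proof -
    have aw: "(a, w) \<in> shadow E'"
      using a by (auto simp: coneighbours_def intro: shadowI)
    have "coneighbours E' a w \<subseteq> ?N a"
      by (auto simp: coneighbours_def intro: shadowI)
    then have "card (coneighbours E' a w) \<le> card (?N a)"
      by (rule card_mono[OF finN])
    then have "6 \<le> card (?N a)"
      using E'(2) aw by (auto simp: rich_def)
    moreover have "card (?N a) - card {w, u} \<le> card (?N a - {w, u})"
      by (rule diff_card_le_card_Diff) simp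
    moreover have "card {w, u} \<le> 2"
      by (simp add: card_insert_if)
    ultimately show ?thesis
      by linarith
  qed
  have "(\<Sum>a\<in>?C. card (?N a - {w, u})) = card (\<Union>a\<in>?C. ?N a - {w, u})"
  proof (rule card_UN_disjoint[symmetric])
    show "\<forall>a\<in>?C. \<forall>b\<in>?C. a \<noteq> b \<longrightarrow> (?N a - {w, u}) \<inter> (?N b - {w, u}) = {}"
      using rich_F7_free_common_neighbours[OF H E' free] by (fastforce simp: coneighbours_def)
  qed (use finC finN in auto)
  also have "\<dots> \<le> card V"
    using NV by (intro card_mono[OF fin]) blast
  finally have "(\<Sum>a\<in>?C. real (card (?N a - {w, u}))) \<le> real (card V)"
    by (metis of_nat_le_iff of_nat_sum)
  moreover have "(\<Sum>a\<in>?C. real (card (?N a))) \<le> (\<Sum>a\<in>?C. 2 * real (card (?N a - {w, u})))"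
    by (rule sum_mono) (rule half)
  ultimately show ?thesis
    by (simp flip: sum_distrib_left)
qed

lemma card_rich_F7_free:
  assumes H: "triple_system (V, E)" and E': "E' \<subseteq> E" "rich 6 E'"
    and free: "\<not> contains_copy (V, E) F7"
  shows "card E' \<le> 2 * (card V)\<^sup>2"
proof -
  let ?Q = "{(w, u, a). {w, u, a} \<in> E'}"
  have fin: "finite V" and EV: "\<forall>e\<in>E'. e \<subseteq> V" and three: "\<And>e. e \<in> E' \<Longrightarrow> card e = 3"
    using H E'(1) by (auto simp: triple_system_def)
  have "?Q \<subseteq> V \<times> V \<times> V"
    using EV by auto
  then have "finite ?Q"
    using fin by (meson finite_SigmaI finite_subset)
  moreover have "E' \<subseteq> (\<lambda>(w, u, a). {w, u, a}) ` ?Q"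
  proof
    fix e
    assume e: "e \<in> E'"
    then obtain w u a where "e = {w, u, a}"
      using three by (metis card_3_iff)
    then show "e \<in> (\<lambda>(w, u, a). {w, u, a}) ` ?Q"
      using e by (intro image_eqI[where x = "(w, u, a)"]) auto
  qed
  ultimately have "card E' \<le> card ?Q"
    by (rule surj_card_le)
  also have "real (card ?Q) \<le> 2 * real (card V) * real (card V)"
    by (rule card_ordered_triples_le[OF fin EV refl rich_F7_free_degree_sum[OF H E' free]]) simp
  finally have "real (card E') \<le> real (2 * (card V)\<^sup>2)"
    by (simp add: power2_eq_square)
  then show ?thesis
    by (simp only: of_nat_le_iff)
qed

lemma card_F1_or_F7_free:
  assumes H: "triple_system (V, E)"
    and free: "\<not> contains_copy (V, E) F1 \<or> \<not> contains_copy (V, E) F7"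
  shows "card E \<le> 8 * (card V)\<^sup>2"
proof -
  have "finite V" "\<forall>e\<in>E. e \<subseteq> V \<and> card e = 3"
    using H by (auto simp: triple_system_def)
  then obtain E' where E': "E' \<subseteq> E" "rich 6 E'" "card E \<le> card E' + 6 * (card V)\<^sup>2"
    by (rule exists_rich_subsystem)
  have "card E' \<le> 2 * (card V)\<^sup>2"
    using free rich_F1_free_empty[OF H E'(1,2)] card_rich_F7_free[OF H E'(1,2)] by auto
  then show ?thesis
    using E'(3) by linarith
qed

section \<open>The order of magnitude\<close>

lemma ex_number_bounds:
  fixes H :: "nat hypergraph"
  assumes lower: "triple_system H" "card (fst H) = n" "\<forall>F\<in>\<A>. \<not> contains_copy H F"
    and upper: "\<And>H' :: nat hypergraph. triple_system H' \<Longrightarrow> card (fst H') = n \<Longrightarrow>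
      \<forall>F\<in>\<A>. \<not> contains_copy H' F \<Longrightarrow> card (snd H') \<le> b"
  shows "card (snd H) \<le> ex_number n \<A>" "ex_number n \<A> \<le> b"
proof -
  let ?X = "{card (snd H) | H :: nat hypergraph.
    triple_system H \<and> card (fst H) = n \<and> (\<forall>F\<in>\<A>. \<not> contains_copy H F)}"
  have "?X \<subseteq> {..b}"
    using upper by auto
  then have fin: "finite ?X"
    by (rule finite_subset) simp
  moreover have mem: "card (snd H) \<in> ?X"
    using lower by blast
  ultimately show "card (snd H) \<le> ex_number n \<A>"
    unfolding ex_number_def by (rule Max_ge)
  have "Max ?X \<in> ?X"
    using fin mem by (intro Max_in) auto
  then show "ex_number n \<A> \<le> b"
    using \<open>?X \<subseteq> {..b}\<close> unfolding ex_number_def by blast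
qed

theorem proposition5:
  fixes \<A> :: "nat hypergraph set"
  assumes "\<A> \<subseteq> special_four_cycles - {F3}"
    and "\<A> \<inter> {F1, F7} \<noteq> {}"
  shows "(\<lambda>n. real (ex_number n \<A>)) \<in> \<Theta>(\<lambda>n. real n ^ 2)"
proof -
  have bounds: "card (paired_triples (n div 4) n) \<le> ex_number n \<A>" "ex_number n \<A> \<le> 8 * n\<^sup>2" for n
  proof -
    let ?H = "({..<n}, paired_triples (n div 4) n)"
    have upper: "card (snd H') \<le> 8 * n\<^sup>2"
      if "triple_system H'" "card (fst H') = n" "\<forall>F\<in>\<A>. \<not> contains_copy H' F"
      for H' :: "nat hypergraph"
    proof -
      have "\<not> contains_copy H' F1 \<or> \<not> contains_copy H' F7"
        using that(3) assms(2) by blast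
      then show ?thesis
        using card_F1_or_F7_free[of "fst H'" "snd H'"] that(1,2) by simp
    qed
    have sys: "triple_system ?H"
      by (rule triple_system_paired_triples) linarith
    have free: "\<forall>F\<in>\<A>. \<not> contains_copy ?H F"
      using assms(1) paired_triples_free by blast
    have n: "card (fst ?H) = n"
      by simp
    note b = ex_number_bounds[OF sys n free, of "8 * n\<^sup>2"]
    show "card (paired_triples (n div 4) n) \<le> ex_number n \<A>"
      using b(1) upper by (simp only: snd_conv)
    show "ex_number n \<A> \<le> 8 * n\<^sup>2"
      by (rule b(2)) (rule upper)
  qed
  have "(\<lambda>n. real (ex_number n \<A>)) \<in> O(\<lambda>n. real n ^ 2)"
  proof (rule bigoI[where c = 8], rule always_eventually, rule allI)
    fix n
    have "real (ex_number n \<A>) \<le> real (8 * n\<^sup>2)"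
      using bounds(2)[of n] by (simp only: of_nat_le_iff)
    then show "norm (real (ex_number n \<A>)) \<le> 8 * norm (real n ^ 2)"
      by simp
  qed
  moreover have "(\<lambda>n. real (ex_number n \<A>)) \<in> \<Omega>(\<lambda>n. real n ^ 2)"
  proof (rule landau_omega.bigI[where c = "1 / 16"])
    show "\<forall>\<^sub>F n in at_top. 1 / 16 * norm (real n ^ 2) \<le> norm (real (ex_number n \<A>))"
      using eventually_ge_at_top[of 6]
    proof eventually_elim
      case (elim n)
      \<comment> \<open>\<open>n div 4 \<ge> (n - 3) / 4\<close>, which is at least \<open>n / 8\<close> from \<open>n = 6\<close> on.\<close>
      have "n \<le> 8 * (n div 4)" "n \<le> 2 * (n - 2 * (n div 4))"
        using elim by presburger+
      then have "n * n \<le> (8 * (n div 4)) * (2 * (n - 2 * (n div 4)))"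
        by (rule mult_le_mono)
      also have "\<dots> = 16 * card (paired_triples (n div 4) n)"
        by (simp add: card_paired_triples)
      also have "\<dots> \<le> 16 * ex_number n \<A>"
        using bounds(1)[of n] by simp
      finally have "real (n * n) \<le> real (16 * ex_number n \<A>)"
        by (simp only: of_nat_le_iff)
      then show ?case
        by (simp add: power2_eq_square)
    qed
  qed simp
  ultimately show ?thesis
    by (rule bigthetaI)
qed

end
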